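(* Let $\Gamma=(V,E)$ and $\Gamma'=(V',E')$ be finite connected simple graphs, both regular of the same degree $d\ge1$, with $m=|V|$ and $n=|V'|$. Let $0=\lambda'_0<\lambda'_1\leq\cdots\leq\lambda'_{n-1}$ be the eigenvalues of the normalized Laplacian $\mathcal{L}'$ of $\Gamma'$. Let $C$ be the circle $\{\alpha\in\mathbb{C}:|\alpha-(2+\lambda'_1/2)|=2\}$, traversed clockwise. Let $\mathcal{G}_\alpha,\mathcal{G}$ (resp. $\mathcal{G}'_\alpha,\mathcal{G}'$) be the generalized Green's function and normalized Green's function of $\Gamma$ (resp. $\Gamma'$), and let $\mathbf{G}$ be the normalized Green's function of $\Gamma\times\Gamma'$. Then for all $x,y\in V$, $x',y'\in V'$, $$\mathbf{G}((x,x'),(y,y'))=\frac{1}{\pi i}\int_C\mathcal{G}_\alpha(x,y)\,\mathcal{G}'_{-\alpha}(x',y')\,d\alpha+\frac{2}{n}\mathcal{G}(x,y)+\frac{2}{m}\mathcal{G}'(x',y').$$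
   Context: For a connected $\delta$-regular graph $\Gamma=(V,E)$, the normalized Laplacian $\mathcal{L}$ is the $V\times V$ matrix with $\mathcal{L}(x,x)=1$, $\mathcal{L}(x,y)=-1/\delta$ if $x\sim y$, $0$ otherwise. Let $\{(\lambda_j,\phi_j)\}$ be an orthonormal eigensystem of $\mathcal{L}$ (possibly complex eigenvectors, orthonormal for $\langle f,g\rangle=\sum f\overline g$); the eigenvalue $0$ is simple with eigenvector constant $1/\sqrt{|V|}$. For $\alpha\in\mathbb{C}$ with $-\alpha$ not a positive eigenvalue, the generalized Green's function is $\mathcal{G}_\alpha(x,y)=\sum_{j:\lambda_j>0}\frac{1}{\lambda_j+\alpha}\phi_j(x)\overline{\phi_j(y)}$ (equivalently the symmetric matrix with $(\mathcal{L}+\alpha)\mathcal{G}_\alpha=I-P_0$, $\mathcal{G}_\alpha P_0=0$, $P_0$ the projection onto the constants), and the normalized Green's function is $\mathcal{G}=\mathcal{G}_0$. The Cartesian product $\Gamma\times\Gamma'$ has vertex set $V\times V'$ with $(v,v')\sim(u,u')$ iff ($v=u$, $v'\sim u'$) or ($v'=u'$, $v\sim u$); its normalized Green's function $\mathbf{G}$ is defined in the same way from its normalized Laplacian. *)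

theory Defs
  imports "HOL-Complex_Analysis.Complex_Analysis" "Graph_Theory.Graph_Theory"
begin

text \<open>
  Finite simple graphs are the \<open>pair_graph\<close>s of \<open>Graph_Theory\<close>: finite, loop-free digraphs
  without parallel arcs whose arc relation \<open>parcs\<close> is symmetric, so that adjacency of \<open>x\<close> and
  \<open>y\<close> is \<open>(x, y) \<in> parcs G\<close> and the out-degree is the usual degree.
\<close>

definition regular_graph :: "'a pair_pre_digraph \<Rightarrow> nat \<Rightarrow> bool" where
  "regular_graph G d \<longleftrightarrow> (\<forall>v\<in>pverts G. out_degree (with_proj G) v = d)"

definition cartesian_product ::
  "'a pair_pre_digraph \<Rightarrow> 'b pair_pre_digraph \<Rightarrow> ('a \<times> 'b) pair_pre_digraph" where
  "cartesian_product G H =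
     \<lparr> pverts = pverts G \<times> pverts H,
       parcs = {((v, v'), (u, u')) | v v' u u'.
                  (v \<in> pverts G \<and> v = u \<and> (v', u') \<in> parcs H) \<or>
                  (v' \<in> pverts H \<and> v' = u' \<and> (v, u) \<in> parcs G)} \<rparr>"

text \<open>
  Only used for regular graphs, where the degree of the row vertex is the common degree.
\<close>

definition normalized_laplacian :: "'a pair_pre_digraph \<Rightarrow> 'a \<Rightarrow> 'a \<Rightarrow> real" where
  "normalized_laplacian G x y =
     (if x = y then 1
      else if (x, y) \<in> parcs G then - 1 / real (out_degree (with_proj G) x)
      else 0)"

text \<open>
  The eigensystem is indexed by \<open>j < |V|\<close>, eigenvalues being repeated according to multiplicity;
  \<open>|V|\<close> orthonormal vectors in the \<open>|V|\<close>-dimensional space of functions on \<open>V\<close> form a basis.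
  The eigenvalues are real because the matrix is symmetric.
\<close>

definition orthonormal_eigensystem ::
  "'a pair_pre_digraph \<Rightarrow> (nat \<Rightarrow> real) \<Rightarrow> (nat \<Rightarrow> 'a \<Rightarrow> complex) \<Rightarrow> bool" where
  "orthonormal_eigensystem G ev \<phi> \<longleftrightarrow>
     (\<forall>j < card (pverts G). \<forall>x \<in> pverts G.
        (\<Sum>y\<in>pverts G. of_real (normalized_laplacian G x y) * \<phi> j y) = of_real (ev j) * \<phi> j x) \<and>
     (\<forall>j < card (pverts G). \<forall>k < card (pverts G).
        (\<Sum>x\<in>pverts G. \<phi> j x * cnj (\<phi> k x)) = (if j = k then 1 else 0))"

text \<open>
  The value does not depend on which orthonormal eigensystem \<open>(ev, \<phi>)\<close> of \<open>G\<close> is used.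
  It is meaningful when \<open>-\<alpha>\<close> is not a positive eigenvalue.
\<close>

definition generalized_green ::
  "'a pair_pre_digraph \<Rightarrow> (nat \<Rightarrow> real) \<Rightarrow> (nat \<Rightarrow> 'a \<Rightarrow> complex) \<Rightarrow> complex \<Rightarrow> 'a \<Rightarrow> 'a \<Rightarrow> complex"
  where
  "generalized_green G ev \<phi> \<alpha> x y =
     (\<Sum>j | j < card (pverts G) \<and> ev j > 0. 1 / (of_real (ev j) + \<alpha>) * \<phi> j x * cnj (\<phi> j y))"

definition normalized_green ::
  "'a pair_pre_digraph \<Rightarrow> (nat \<Rightarrow> real) \<Rightarrow> (nat \<Rightarrow> 'a \<Rightarrow> complex) \<Rightarrow> 'a \<Rightarrow> 'a \<Rightarrow> complex" where
  "normalized_green G ev \<phi> = generalized_green G ev \<phi> 0"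

end

theory Submission
  imports Defs
begin

text \<open>
  The Laplacian of the product is the average of \<open>L \<otimes> 1\<close> and \<open>1 \<otimes> L'\<close>, so the functions
  \<open>\<phi>\<^sub>j \<otimes> \<phi>'\<^sub>k\<close> form an orthonormal eigenbasis with eigenvalues \<open>(\<lambda>\<^sub>j + \<lambda>'\<^sub>k) / 2\<close>. The kernel of a
  function of a matrix does not depend on the eigenbasis, hence the Green's function of the product is
  the sum of \<open>2 / (\<lambda>\<^sub>j + \<lambda>'\<^sub>k)\<close> times the rank-one projections over \<open>(j, k) \<noteq> (0, 0)\<close>. By connectedness
  the eigenvalue \<open>0\<close> of each factor is simple with a constant eigenvector, so the terms with \<open>k = 0\<close>
  or \<open>j = 0\<close> give the two single Green's functions. As a function of \<open>\<alpha>\<close>, \<open>\<G>'\<close> at \<open>-\<alpha>\<close> has simple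
  poles at the positive \<open>\<lambda>'\<^sub>k\<close>, which lie between \<open>\<lambda>'\<^sub>1\<close> and \<open>2\<close> and thus inside the circle, while \<open>\<G>\<close> at
  \<open>\<alpha>\<close> is holomorphic in the right half-plane; Cauchy's integral formula yields the remaining terms.
\<close>

section \<open>Orthonormal bases of functions on a finite set\<close>

definition inner_on :: "'v set \<Rightarrow> ('v \<Rightarrow> complex) \<Rightarrow> ('v \<Rightarrow> complex) \<Rightarrow> complex" where
  "inner_on V f g = (\<Sum>x\<in>V. f x * cnj (g x))"

definition mat_apply :: "'v set \<Rightarrow> ('v \<Rightarrow> 'v \<Rightarrow> complex) \<Rightarrow> ('v \<Rightarrow> complex) \<Rightarrow> 'v \<Rightarrow> complex" where
  "mat_apply V A f x = (\<Sum>y\<in>V. A x y * f y)"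

definition eigenfunction_on ::
  "'v set \<Rightarrow> ('v \<Rightarrow> 'v \<Rightarrow> complex) \<Rightarrow> real \<Rightarrow> ('v \<Rightarrow> complex) \<Rightarrow> bool" where
  "eigenfunction_on V A \<nu> f \<longleftrightarrow> (\<forall>x\<in>V. mat_apply V A f x = of_real \<nu> * f x)"

definition spectral_kernel ::
  "'i set \<Rightarrow> ('i \<Rightarrow> complex) \<Rightarrow> ('i \<Rightarrow> 'v \<Rightarrow> complex) \<Rightarrow> 'v \<Rightarrow> 'v \<Rightarrow> complex" where
  "spectral_kernel I w \<psi> x y = (\<Sum>i\<in>I. w i * \<psi> i x * cnj (\<psi> i y))"

lemma
  fixes f :: "'a \<Rightarrow> 'b::semiring_1"
  assumes "finite A" and "a \<in> A"
  shows sum_of_bool_eq_self_mult: "(\<Sum>x\<in>A. of_bool (a = x) * f x) = f a"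
    and sum_mult_of_bool_eq_self: "(\<Sum>x\<in>A. f x * of_bool (x = a)) = f a"
proof -
  have "A \<inter> {x. a = x} = {a}" "A \<inter> {x. x = a} = {a}"
    using assms by auto
  then show "(\<Sum>x\<in>A. of_bool (a = x) * f x) = f a" "(\<Sum>x\<in>A. f x * of_bool (x = a)) = f a"
    using assms by simp_all
qed

lemma of_real_of_bool: "of_real (of_bool b) = of_bool b"
  by (cases b) simp_all

lemma inner_on_self: "inner_on V f f = of_real (\<Sum>x\<in>V. (cmod (f x))\<^sup>2)"
  by (simp only: inner_on_def of_real_sum complex_norm_square)

lemma mat_apply_spectral_kernel:
  "mat_apply V (spectral_kernel I w \<psi>) f x = (\<Sum>i\<in>I. w i * inner_on V f (\<psi> i) * \<psi> i x)"
proof -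
  have "mat_apply V (spectral_kernel I w \<psi>) f x = (\<Sum>z\<in>V. \<Sum>i\<in>I. w i * \<psi> i x * cnj (\<psi> i z) * f z)"
    by (simp add: mat_apply_def spectral_kernel_def sum_distrib_right)
  also have "\<dots> = (\<Sum>i\<in>I. \<Sum>z\<in>V. w i * \<psi> i x * cnj (\<psi> i z) * f z)"
    by (rule sum.swap)
  finally show ?thesis
    by (simp add: inner_on_def sum_distrib_left sum_distrib_right mult_ac)
qed

lemma cnj_spectral_kernel:
  "cnj (spectral_kernel I w \<psi> x y) = spectral_kernel I (\<lambda>i. cnj (w i)) \<psi> y x"
  by (simp add: spectral_kernel_def mult_ac)

locale orthonormal_basis =
  fixes V :: "'v set" and I :: "'i set" and \<psi> :: "'i \<Rightarrow> 'v \<Rightarrow> complex"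
  assumes finite_points: "finite V" and finite_index: "finite I" and card_index: "card I = card V"
    and orthonormal: "\<And>i j. i \<in> I \<Longrightarrow> j \<in> I \<Longrightarrow> inner_on V (\<psi> i) (\<psi> j) = of_bool (i = j)"
begin

lemma inner_on_linear_combination:
  assumes "i \<in> I"
  shows "inner_on V (\<lambda>x. \<Sum>j\<in>I. c j * \<psi> j x) (\<psi> i) = c i"
proof -
  have "inner_on V (\<lambda>x. \<Sum>j\<in>I. c j * \<psi> j x) (\<psi> i) = (\<Sum>x\<in>V. \<Sum>j\<in>I. c j * (\<psi> j x * cnj (\<psi> i x)))"
    by (simp add: inner_on_def sum_distrib_right mult.assoc)
  also have "\<dots> = (\<Sum>j\<in>I. c j * inner_on V (\<psi> j) (\<psi> i))"
    by (subst sum.swap) (simp add: inner_on_def sum_distrib_left)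
  also have "\<dots> = (\<Sum>j\<in>I. c j * of_bool (j = i))"
    using assms by (intro sum.cong refl) (simp add: orthonormal)
  also have "\<dots> = c i"
    using finite_index assms by (rule sum_mult_of_bool_eq_self)
  finally show ?thesis .
qed

lemma spectral_kernel_comp:
  "mat_apply V (spectral_kernel I w \<psi>) (\<lambda>z. spectral_kernel I u \<psi> z y) x
    = spectral_kernel I (\<lambda>i. w i * u i) \<psi> x y"
proof -
  have "inner_on V (\<lambda>z. spectral_kernel I u \<psi> z y) (\<psi> i) = u i * cnj (\<psi> i y)" if "i \<in> I" for i
    using inner_on_linear_combination[OF that, of "\<lambda>j. u j * cnj (\<psi> j y)"]
    by (simp add: spectral_kernel_def mult_ac)
  then show ?thesis
    unfolding mat_apply_spectral_kernel spectral_kernel_def[of I "\<lambda>i. w i * u i"]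
    by (intro sum.cong refl) simp
qed

lemma trace_spectral_kernel: "(\<Sum>x\<in>V. spectral_kernel I w \<psi> x x) = (\<Sum>i\<in>I. w i)"
proof -
  have "(\<Sum>x\<in>V. spectral_kernel I w \<psi> x x) = (\<Sum>i\<in>I. w i * inner_on V (\<psi> i) (\<psi> i))"
    unfolding spectral_kernel_def inner_on_def
    by (subst sum.swap) (simp add: sum_distrib_left mult.assoc)
  then show ?thesis
    by (simp add: orthonormal)
qed

lemma norm_square_indicator_minus_projection:
  assumes "x \<in> V"
  shows "(\<Sum>y\<in>V. (cmod (of_bool (x = y) - spectral_kernel I (\<lambda>_. 1) \<psi> x y))\<^sup>2)
    = 1 - Re (spectral_kernel I (\<lambda>_. 1) \<psi> x x)"
proof -
  let ?P = "spectral_kernel I (\<lambda>_. 1) \<psi>"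
  have "of_real (\<Sum>y\<in>V. (cmod (of_bool (x = y) - ?P x y))\<^sup>2)
      = (\<Sum>y\<in>V. (of_bool (x = y) - ?P x y) * cnj (of_bool (x = y) - ?P x y))"
    by (simp only: of_real_sum complex_norm_square)
  also have "\<dots> = (\<Sum>y\<in>V. of_bool (x = y) * (1 - 2 * ?P x x) + ?P x y * ?P y x)"
    by (intro sum.cong refl) (auto simp: cnj_spectral_kernel algebra_simps)
  also have "\<dots> = (\<Sum>y\<in>V. of_bool (x = y) * (1 - 2 * ?P x x)) + (\<Sum>y\<in>V. ?P x y * ?P y x)"
    by (rule sum.distrib)
  also have "(\<Sum>y\<in>V. of_bool (x = y) * (1 - 2 * ?P x x)) = 1 - 2 * ?P x x"
    using finite_points assms by (rule sum_of_bool_eq_self_mult)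
  also have "(\<Sum>y\<in>V. ?P x y * ?P y x) = ?P x x"
    using spectral_kernel_comp[of "\<lambda>_. 1" "\<lambda>_. 1" x x]
    by (simp add: mat_apply_def)
  finally have "complex_of_real (\<Sum>y\<in>V. (cmod (of_bool (x = y) - ?P x y))\<^sup>2) = 1 - ?P x x"
    by simp
  then show ?thesis
    by (metis Re_complex_of_real minus_complex.sel(1) one_complex.sel(1))
qed

text \<open>
  The squared distances of the indicators to their orthogonal projections are nonnegative and add
  up to \<open>card V - card I = 0\<close>.
\<close>

lemma completeness:
  assumes x: "x \<in> V" and y: "y \<in> V"
  shows "spectral_kernel I (\<lambda>_. 1) \<psi> x y = of_bool (x = y)"
proof -
  let ?P = "spectral_kernel I (\<lambda>_. 1) \<psi>"
  have "(\<Sum>z\<in>V. \<Sum>w\<in>V. (cmod (of_bool (z = w) - ?P z w))\<^sup>2) = (\<Sum>z\<in>V. 1 - Re (?P z z))"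
    by (intro sum.cong refl norm_square_indicator_minus_projection)
  also have "\<dots> = of_nat (card V) - Re (\<Sum>z\<in>V. ?P z z)"
    by (simp add: sum_subtractf)
  also have "\<dots> = 0"
    by (simp add: trace_spectral_kernel card_index)
  finally have "\<forall>z\<in>V. \<forall>w\<in>V. (cmod (of_bool (z = w) - ?P z w))\<^sup>2 = 0"
    by (simp add: finite_points sum_nonneg_eq_0_iff sum_nonneg)
  then show ?thesis
    using x y by simp
qed

lemma basis_expansion:
  assumes "x \<in> V"
  shows "(\<Sum>i\<in>I. inner_on V f (\<psi> i) * \<psi> i x) = f x"
proof -
  have "(\<Sum>i\<in>I. inner_on V f (\<psi> i) * \<psi> i x) = (\<Sum>z\<in>V. spectral_kernel I (\<lambda>_. 1) \<psi> x z * f z)"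
    using mat_apply_spectral_kernel[of V I "\<lambda>_. 1" \<psi> f x] by (simp add: mat_apply_def)
  also have "\<dots> = (\<Sum>z\<in>V. of_bool (x = z) * f z)"
    using assms by (simp add: completeness)
  also have "\<dots> = f x"
    using finite_points assms by (rule sum_of_bool_eq_self_mult)
  finally show ?thesis .
qed

end

section \<open>Functions of a matrix with an orthonormal eigenbasis\<close>

locale orthonormal_eigenbasis = orthonormal_basis V I \<psi>
  for V :: "'v set" and I :: "'i set" and \<psi> :: "'i \<Rightarrow> 'v \<Rightarrow> complex" +
  fixes A :: "'v \<Rightarrow> 'v \<Rightarrow> complex" and \<mu> :: "'i \<Rightarrow> real"
  assumes eigenfunction: "\<And>i. i \<in> I \<Longrightarrow> eigenfunction_on V A (\<mu> i) (\<psi> i)"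
begin

lemma mat_apply_expansion:
  assumes "x \<in> V"
  shows "mat_apply V A f x = (\<Sum>i\<in>I. inner_on V f (\<psi> i) * of_real (\<mu> i) * \<psi> i x)"
proof -
  have "mat_apply V A f x = (\<Sum>y\<in>V. \<Sum>i\<in>I. inner_on V f (\<psi> i) * (A x y * \<psi> i y))"
    unfolding mat_apply_def
    by (intro sum.cong refl, subst basis_expansion[symmetric, where f = f])
      (simp_all add: sum_distrib_left mult_ac)
  also have "\<dots> = (\<Sum>i\<in>I. inner_on V f (\<psi> i) * mat_apply V A (\<psi> i) x)"
    by (subst sum.swap) (simp add: mat_apply_def sum_distrib_left)
  finally show ?thesis
    using assms eigenfunction by (simp add: eigenfunction_on_def mult.assoc)
qed

lemma inner_on_eigenfunction_eq_0:
  assumes f: "eigenfunction_on V A \<nu> f" and i: "i \<in> I" and "\<mu> i \<noteq> \<nu>"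
  shows "inner_on V f (\<psi> i) = 0"
proof -
  define c where "c j = inner_on V f (\<psi> j) * of_real (\<mu> j)" for j
  have "of_real \<nu> * f x = (\<Sum>j\<in>I. c j * \<psi> j x)" if "x \<in> V" for x
    using f that mat_apply_expansion[OF that, of f] by (simp add: eigenfunction_on_def c_def)
  then have "of_real \<nu> * inner_on V f (\<psi> i) = inner_on V (\<lambda>x. \<Sum>j\<in>I. c j * \<psi> j x) (\<psi> i)"
    by (simp add: inner_on_def sum_distrib_left flip: mult.assoc)
  also have "\<dots> = inner_on V f (\<psi> i) * of_real (\<mu> i)"
    by (simp add: inner_on_linear_combination[OF i] c_def)
  finally show ?thesis
    using \<open>\<mu> i \<noteq> \<nu>\<close> by simp
qed

lemma eigenfunction_spectral_kernel:
  assumes f: "eigenfunction_on V A \<nu> f" and x: "x \<in> V"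
  shows "mat_apply V (spectral_kernel I (\<lambda>i. h (\<mu> i)) \<psi>) f x = h \<nu> * f x"
proof -
  have coefficient: "h (\<mu> i) * inner_on V f (\<psi> i) = h \<nu> * inner_on V f (\<psi> i)" if "i \<in> I" for i
    using inner_on_eigenfunction_eq_0[OF f that] by (cases "\<mu> i = \<nu>") auto
  have "mat_apply V (spectral_kernel I (\<lambda>i. h (\<mu> i)) \<psi>) f x
      = (\<Sum>i\<in>I. h \<nu> * (inner_on V f (\<psi> i) * \<psi> i x))"
    unfolding mat_apply_spectral_kernel
    by (intro sum.cong refl) (simp only: coefficient mult.assoc[symmetric])
  also have "\<dots> = h \<nu> * f x"
    by (simp add: basis_expansion[OF x] flip: sum_distrib_left)
  finally show ?thesis .
qed

end

lemma spectral_kernel_unique: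
  assumes "orthonormal_eigenbasis V I \<psi> A \<mu>" and "orthonormal_eigenbasis V J \<theta> A \<nu>"
    and x: "x \<in> V" and y: "y \<in> V"
  shows "spectral_kernel I (\<lambda>i. h (\<mu> i)) \<psi> x y = spectral_kernel J (\<lambda>j. h (\<nu> j)) \<theta> x y"
proof -
  interpret P: orthonormal_eigenbasis V I \<psi> A \<mu> by fact
  interpret Q: orthonormal_eigenbasis V J \<theta> A \<nu> by fact
  let ?K = "spectral_kernel I (\<lambda>i. h (\<mu> i)) \<psi>"
  have "?K x y = (\<Sum>z\<in>V. ?K x z * of_bool (z = y))"
    using P.finite_points y by (rule sum_mult_of_bool_eq_self[symmetric])
  also have "\<dots> = (\<Sum>z\<in>V. \<Sum>j\<in>J. cnj (\<theta> j y) * (?K x z * \<theta> j z))"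
    using y by (intro sum.cong refl)
      (simp add: spectral_kernel_def[of J] sum_distrib_left mult_ac flip: Q.completeness)
  also have "\<dots> = (\<Sum>j\<in>J. cnj (\<theta> j y) * mat_apply V ?K (\<theta> j) x)"
    by (subst sum.swap) (simp add: mat_apply_def sum_distrib_left)
  also have "\<dots> = (\<Sum>j\<in>J. cnj (\<theta> j y) * (h (\<nu> j) * \<theta> j x))"
    by (intro sum.cong refl) (simp add: P.eigenfunction_spectral_kernel[OF Q.eigenfunction x])
  finally show ?thesis
    by (simp add: spectral_kernel_def[of J] mult_ac)
qed

section \<open>Kronecker sums\<close>

definition tensor :: "('v \<Rightarrow> complex) \<Rightarrow> ('w \<Rightarrow> complex) \<Rightarrow> 'v \<times> 'w \<Rightarrow> complex" where
  "tensor f g = (\<lambda>(x, y). f x * g y)"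

definition weighted_kronecker_sum ::
  "real \<Rightarrow> ('v \<Rightarrow> 'v \<Rightarrow> complex) \<Rightarrow> real \<Rightarrow> ('w \<Rightarrow> 'w \<Rightarrow> complex) \<Rightarrow> 'v \<times> 'w \<Rightarrow> 'v \<times> 'w \<Rightarrow> complex" where
  "weighted_kronecker_sum a A b B = (\<lambda>(x, x') (y, y').
     of_real a * (A x y * of_bool (x' = y')) + of_real b * (of_bool (x = y) * B x' y'))"

lemma inner_on_tensor:
  "inner_on (V \<times> W) (tensor f g) (tensor f' g') = inner_on V f f' * inner_on W g g'"
  by (simp add: inner_on_def tensor_def sum_product sum.cartesian_product case_prod_beta mult_ac)

lemma spectral_kernel_tensor:
  "spectral_kernel (I \<times> J) (\<lambda>(i, j). w i j) (\<lambda>(i, j). tensor (\<psi> i) (\<theta> j)) (x, x') (y, y')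
    = (\<Sum>j\<in>J. spectral_kernel I (\<lambda>i. w i j) \<psi> x y * (\<theta> j x' * cnj (\<theta> j y')))"
proof -
  have "spectral_kernel (I \<times> J) (\<lambda>(i, j). w i j) (\<lambda>(i, j). tensor (\<psi> i) (\<theta> j)) (x, x') (y, y')
      = (\<Sum>i\<in>I. \<Sum>j\<in>J. w i j * (\<psi> i x * \<theta> j x') * cnj (\<psi> i y * \<theta> j y'))"
    by (simp add: spectral_kernel_def tensor_def sum.cartesian_product case_prod_beta)
  also have "\<dots> = (\<Sum>j\<in>J. \<Sum>i\<in>I. w i j * (\<psi> i x * \<theta> j x') * cnj (\<psi> i y * \<theta> j y'))"
    by (rule sum.swap)
  also have "\<dots> = (\<Sum>j\<in>J. spectral_kernel I (\<lambda>i. w i j) \<psi> x y * (\<theta> j x' * cnj (\<theta> j y')))"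
    by (simp add: spectral_kernel_def sum_distrib_left sum_distrib_right mult_ac)
  finally show ?thesis .
qed

lemma spectral_kernel_tensor_mult:
  "spectral_kernel (I \<times> J) (\<lambda>(i, j). w i * u j) (\<lambda>(i, j). tensor (\<psi> i) (\<theta> j)) (x, x') (y, y')
    = spectral_kernel I w \<psi> x y * spectral_kernel J u \<theta> x' y'"
proof -
  have "spectral_kernel I (\<lambda>i. w i * u j) \<psi> x y = u j * spectral_kernel I w \<psi> x y" for j
    by (simp add: spectral_kernel_def sum_distrib_left mult_ac)
  then show ?thesis
    by (simp add: spectral_kernel_tensor spectral_kernel_def[of J] sum_distrib_left mult_ac)
qed

lemma mat_apply_weighted_kronecker_sum_tensor:
  assumes "finite V" and "finite W" and x: "x \<in> V" and x': "x' \<in> W"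
  shows "mat_apply (V \<times> W) (weighted_kronecker_sum a A b B) (tensor f g) (x, x')
    = of_real a * (mat_apply V A f x * g x') + of_real b * (f x * mat_apply W B g x')"
proof -
  have "mat_apply (V \<times> W) (weighted_kronecker_sum a A b B) (tensor f g) (x, x')
      = (\<Sum>y\<in>V. \<Sum>y'\<in>W. of_real a * (A x y * f y * (of_bool (x' = y') * g y'))
          + of_real b * (of_bool (x = y) * f y * (B x' y' * g y')))"
    by (simp add: mat_apply_def weighted_kronecker_sum_def tensor_def sum.cartesian_product
        case_prod_beta algebra_simps)
  also have "\<dots> = of_real a * ((\<Sum>y\<in>V. A x y * f y) * (\<Sum>y'\<in>W. of_bool (x' = y') * g y'))
      + of_real b * ((\<Sum>y\<in>V. of_bool (x = y) * f y) * (\<Sum>y'\<in>W. B x' y' * g y'))"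
    by (simp only: sum.distrib flip: sum_distrib_left sum_distrib_right)
  also have "(\<Sum>y'\<in>W. of_bool (x' = y') * g y') = g x'"
    using \<open>finite W\<close> x' by (rule sum_of_bool_eq_self_mult)
  also have "(\<Sum>y\<in>V. of_bool (x = y) * f y) = f x"
    using \<open>finite V\<close> x by (rule sum_of_bool_eq_self_mult)
  finally show ?thesis
    by (simp add: mat_apply_def)
qed

lemma orthonormal_eigenbasis_weighted_kronecker_sum:
  assumes "orthonormal_eigenbasis V I \<psi> A \<mu>" and "orthonormal_eigenbasis W J \<theta> B \<nu>"
  shows "orthonormal_eigenbasis (V \<times> W) (I \<times> J) (\<lambda>(i, j). tensor (\<psi> i) (\<theta> j))
    (weighted_kronecker_sum a A b B) (\<lambda>(i, j). a * \<mu> i + b * \<nu> j)"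
proof -
  interpret P: orthonormal_eigenbasis V I \<psi> A \<mu> by fact
  interpret Q: orthonormal_eigenbasis W J \<theta> B \<nu> by fact
  show ?thesis
  proof
    show "finite (V \<times> W)" "finite (I \<times> J)" "card (I \<times> J) = card (V \<times> W)"
      by (simp_all add: P.finite_points P.finite_index P.card_index
          Q.finite_points Q.finite_index Q.card_index card_cartesian_product)
  next
    fix k l assume "k \<in> I \<times> J" "l \<in> I \<times> J"
    then show "inner_on (V \<times> W) (case k of (i, j) \<Rightarrow> tensor (\<psi> i) (\<theta> j))
        (case l of (i, j) \<Rightarrow> tensor (\<psi> i) (\<theta> j)) = of_bool (k = l)"
      by (auto simp: inner_on_tensor P.orthonormal Q.orthonormal)
  next
    fix k assume "k \<in> I \<times> J"
    then show "eigenfunction_on (V \<times> W) (weighted_kronecker_sum a A b B)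
        (case k of (i, j) \<Rightarrow> a * \<mu> i + b * \<nu> j) (case k of (i, j) \<Rightarrow> tensor (\<psi> i) (\<theta> j))"
      using P.eigenfunction Q.eigenfunction
      by (auto simp: eigenfunction_on_def P.finite_points Q.finite_points tensor_def algebra_simps
          mat_apply_weighted_kronecker_sum_tensor[unfolded tensor_def])
  qed
qed

definition green_weight :: "complex \<Rightarrow> real \<Rightarrow> complex" where
  "green_weight \<alpha> t = (if t > 0 then 1 / (of_real t + \<alpha>) else 0)"

lemma green_weight_weighted_sum:
  assumes "a > 0" and "b > 0" and "s \<ge> 0" and "t \<ge> 0"
  shows "green_weight 0 (a * s + b * t)
    = of_bool (t > 0) * green_weight (of_real (b / a * t)) s / of_real a
      + green_weight 0 s * of_bool (t = 0) / of_real a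
      + of_bool (s = 0) * green_weight 0 t / of_real b"
proof -
  consider (zero) "s = 0 \<or> t = 0" | (positive) "s > 0" "t > 0"
    using assms by linarith
  then show ?thesis
  proof cases
    case positive
    have "a * s + b * t = (s + b / a * t) * a"
      using \<open>a > 0\<close> by (simp add: field_simps)
    then have "complex_of_real (a * s + b * t) = (of_real s + of_real (b / a * t)) * of_real a"
      by (simp only: of_real_add of_real_mult)
    moreover have "a * s + b * t > 0"
      using positive assms by (simp add: add_pos_pos)
    ultimately show ?thesis
      using positive by (simp only: green_weight_def) simp
  qed (use assms in \<open>auto simp: green_weight_def zero_less_mult_iff\<close>)
qed

lemma spectral_kernel_green_weight_tensor:
  assumes "finite J" and "a > 0" and "b > 0"
    and \<mu>: "\<And>i. i \<in> I \<Longrightarrow> \<mu> i \<ge> 0" and \<nu>: "\<And>j. j \<in> J \<Longrightarrow> \<nu> j \<ge> 0"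
  shows "spectral_kernel (I \<times> J) (\<lambda>(i, j). green_weight 0 (a * \<mu> i + b * \<nu> j))
      (\<lambda>(i, j). tensor (\<psi> i) (\<theta> j)) (x, x') (y, y')
    = (\<Sum>j | j \<in> J \<and> \<nu> j > 0. spectral_kernel I (\<lambda>i. green_weight (of_real (b / a * \<nu> j)) (\<mu> i)) \<psi> x y
          * (\<theta> j x' * cnj (\<theta> j y'))) / of_real a
      + spectral_kernel I (\<lambda>i. green_weight 0 (\<mu> i)) \<psi> x y
          * spectral_kernel J (\<lambda>j. of_bool (\<nu> j = 0)) \<theta> x' y' / of_real a
      + spectral_kernel I (\<lambda>i. of_bool (\<mu> i = 0)) \<psi> x y
          * spectral_kernel J (\<lambda>j. green_weight 0 (\<nu> j)) \<theta> x' y' / of_real b"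
proof -
  let ?\<Psi> = "\<lambda>(i, j). tensor (\<psi> i) (\<theta> j)"
  let ?w = "\<lambda>i j. of_bool (\<nu> j > 0) * green_weight (of_real (b / a * \<nu> j)) (\<mu> i)"
  have "spectral_kernel (I \<times> J) (\<lambda>(i, j). green_weight 0 (a * \<mu> i + b * \<nu> j)) ?\<Psi> (x, x') (y, y')
      = spectral_kernel (I \<times> J) (\<lambda>(i, j). ?w i j) ?\<Psi> (x, x') (y, y') / of_real a
        + spectral_kernel (I \<times> J) (\<lambda>(i, j). green_weight 0 (\<mu> i) * of_bool (\<nu> j = 0)) ?\<Psi>
            (x, x') (y, y') / of_real a
        + spectral_kernel (I \<times> J) (\<lambda>(i, j). of_bool (\<mu> i = 0) * green_weight 0 (\<nu> j)) ?\<Psi>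
            (x, x') (y, y') / of_real b"
    unfolding spectral_kernel_def sum_divide_distrib sum.distrib[symmetric]
    using \<mu> \<nu> \<open>a > 0\<close> \<open>b > 0\<close>
    by (intro sum.cong refl) (auto simp: green_weight_weighted_sum algebra_simps)
  moreover have "spectral_kernel (I \<times> J) (\<lambda>(i, j). ?w i j) ?\<Psi> (x, x') (y, y')
      = (\<Sum>j\<in>J. of_bool (\<nu> j > 0)
          * (spectral_kernel I (\<lambda>i. green_weight (of_real (b / a * \<nu> j)) (\<mu> i)) \<psi> x y
              * (\<theta> j x' * cnj (\<theta> j y'))))"
    unfolding spectral_kernel_tensor by (intro sum.cong refl) (auto simp: spectral_kernel_def)
  ultimately show ?thesis
    using \<open>finite J\<close> by (simp add: spectral_kernel_tensor_mult Int_def)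
qed

section \<open>The normalized Laplacian of a regular graph\<close>

abbreviation complex_laplacian :: "'a pair_pre_digraph \<Rightarrow> 'a \<Rightarrow> 'a \<Rightarrow> complex" where
  "complex_laplacian G x y \<equiv> of_real (normalized_laplacian G x y)"

lemma out_degree_with_proj: "out_degree (with_proj G) x = card (parcs G `` {x})"
proof -
  have "out_arcs (with_proj G) x = Pair x ` (parcs G `` {x})"
    by (auto simp: out_arcs_def)
  then show ?thesis
    by (simp add: out_degree_def card_image inj_on_def)
qed

locale regular_pair_graph = pair_graph G for G :: "'a pair_pre_digraph" +
  fixes d :: nat
  assumes regular: "regular_graph G d" and degree_pos: "d > 0"
begin

lemma finite_neighbours: "finite (parcs G `` {x})"
  using pair_finite_arcs by (rule finite_Image)

lemma card_neighbours: "x \<in> pverts G \<Longrightarrow> card (parcs G `` {x}) = d"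
  using regular by (simp add: regular_graph_def out_degree_with_proj)

lemma normalized_laplacian_eq:
  "x \<in> pverts G \<Longrightarrow>
    normalized_laplacian G x y = of_bool (x = y) - of_bool ((x, y) \<in> parcs G) / real d"
  using no_loops' by (auto simp: normalized_laplacian_def out_degree_with_proj card_neighbours)

lemma sum_arcs: "(\<Sum>(x, y)\<in>parcs G. g x y) = (\<Sum>x\<in>pverts G. \<Sum>y\<in>parcs G `` {x}. g x y)"
proof -
  have "parcs G = (SIGMA x:pverts G. parcs G `` {x})"
    using in_arcsD1 by auto
  then show ?thesis
    by (simp add: sum.Sigma pair_finite_verts finite_neighbours)
qed

lemma sum_arcs_swap: "(\<Sum>(x, y)\<in>parcs G. g y x) = (\<Sum>(x, y)\<in>parcs G. g x y)"
  by (rule sum.reindex_bij_witness[of _ prod.swap prod.swap]) (auto intro: arcs_symmetric)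

lemma sum_arcs_tail:
  fixes g :: "'a \<Rightarrow> 'b::semiring_1"
  shows "(\<Sum>(x, y)\<in>parcs G. g x) = of_nat d * (\<Sum>x\<in>pverts G. g x)"
  by (simp add: sum_arcs card_neighbours sum_distrib_left)

lemma mat_apply_laplacian:
  assumes x: "x \<in> pverts G"
  shows "mat_apply (pverts G) (complex_laplacian G) f x = f x - (\<Sum>y\<in>parcs G `` {x}. f y) / of_nat d"
proof -
  have "mat_apply (pverts G) (complex_laplacian G) f x
      = (\<Sum>y\<in>pverts G. of_bool (x = y) * f y)
        - (\<Sum>y\<in>pverts G. of_bool ((x, y) \<in> parcs G) * f y) / of_nat d"
    by (simp add: mat_apply_def normalized_laplacian_eq[OF x] of_real_of_bool left_diff_distrib
        sum_subtractf sum_divide_distrib del: sum_of_bool_mult_eq)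
  moreover have "(\<Sum>y\<in>pverts G. of_bool (x = y) * f y) = f x"
    using pair_finite_verts x by (rule sum_of_bool_eq_self_mult)
  moreover have "pverts G \<inter> {y. (x, y) \<in> parcs G} = parcs G `` {x}"
    using in_arcsD2 by auto
  ultimately show ?thesis
    using pair_finite_verts by simp
qed

definition dirichlet_energy :: "('a \<Rightarrow> complex) \<Rightarrow> real" where
  "dirichlet_energy f = (\<Sum>(x, y)\<in>parcs G. (cmod (f x - f y))\<^sup>2)"

lemma dirichlet_energy_nonneg: "dirichlet_energy f \<ge> 0"
  by (auto simp: dirichlet_energy_def intro: sum_nonneg)

lemma dirichlet_energy_eq_inner_laplacian:
  "of_real (dirichlet_energy f)
    = 2 * of_nat d * inner_on (pverts G) (mat_apply (pverts G) (complex_laplacian G) f) f"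
proof -
  define X where "X = (\<Sum>(x, y)\<in>parcs G. f y * cnj (f x))"
  let ?N = "inner_on (pverts G) f f"
  have tail: "(\<Sum>(x, y)\<in>parcs G. f x * cnj (f x)) = of_nat d * ?N"
    by (simp only: sum_arcs_tail inner_on_def)
  have "of_real (dirichlet_energy f) = (\<Sum>(x, y)\<in>parcs G. (f x - f y) * cnj (f x - f y))"
    by (simp only: dirichlet_energy_def of_real_sum case_prod_unfold complex_norm_square)
  also have "\<dots> = (\<Sum>(x, y)\<in>parcs G. f x * cnj (f x)) + (\<Sum>(x, y)\<in>parcs G. f y * cnj (f y))
      - (\<Sum>(x, y)\<in>parcs G. f y * cnj (f x)) - (\<Sum>(x, y)\<in>parcs G. f x * cnj (f y))"
    unfolding sum.distrib[symmetric] sum_subtractf[symmetric]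
    by (intro sum.cong refl) (auto simp: algebra_simps)
  also have "\<dots> = 2 * (of_nat d * ?N - X)"
    using sum_arcs_swap[of "\<lambda>x y. f x * cnj (f x)"] sum_arcs_swap[of "\<lambda>x y. f y * cnj (f x)"]
    by (simp add: X_def tail)
  finally have energy: "of_real (dirichlet_energy f) = 2 * (of_nat d * ?N - X)" .
  have "of_nat d * inner_on (pverts G) (mat_apply (pverts G) (complex_laplacian G) f) f
      = (\<Sum>x\<in>pverts G. of_nat d * (f x * cnj (f x)) - (\<Sum>y\<in>parcs G `` {x}. f y * cnj (f x)))"
    unfolding inner_on_def sum_distrib_left using degree_pos
    by (intro sum.cong refl) (simp add: mat_apply_laplacian field_simps sum_distrib_left)
  also have "\<dots> = of_nat d * ?N - X"
    by (simp add: X_def sum_arcs sum_subtractf inner_on_def sum_distrib_left)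
  finally show ?thesis
    by (simp add: energy mult.assoc)
qed

lemma dirichlet_energy_le: "dirichlet_energy f \<le> 4 * real d * (\<Sum>x\<in>pverts G. (cmod (f x))\<^sup>2)"
proof -
  have square_bound: "(cmod (u - v))\<^sup>2 \<le> 2 * (cmod u)\<^sup>2 + 2 * (cmod v)\<^sup>2" for u v
  proof -
    have "(cmod (u - v))\<^sup>2 \<le> (cmod u + cmod v)\<^sup>2"
      by (intro power_mono norm_triangle_ineq4) simp
    also have "\<dots> \<le> 2 * (cmod u)\<^sup>2 + 2 * (cmod v)\<^sup>2"
      using sum_squares_bound[of "cmod u" "cmod v"] by (simp add: power2_sum)
    finally show ?thesis .
  qed
  have "dirichlet_energy f \<le> (\<Sum>(x, y)\<in>parcs G. 2 * (cmod (f x))\<^sup>2 + 2 * (cmod (f y))\<^sup>2)"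
    unfolding dirichlet_energy_def by (intro sum_mono) (auto intro: square_bound)
  also have "\<dots> = (\<Sum>(x, y)\<in>parcs G. 2 * (cmod (f x))\<^sup>2) + (\<Sum>(x, y)\<in>parcs G. 2 * (cmod (f y))\<^sup>2)"
    by (simp add: case_prod_beta sum.distrib)
  also have "(\<Sum>(x, y)\<in>parcs G. 2 * (cmod (f y))\<^sup>2) = (\<Sum>(x, y)\<in>parcs G. 2 * (cmod (f x))\<^sup>2)"
    by (rule sum_arcs_swap)
  finally show ?thesis
    by (simp add: sum_arcs_tail flip: sum_distrib_left)
qed

lemma dirichlet_energy_eigenfunction:
  assumes "eigenfunction_on (pverts G) (complex_laplacian G) \<nu> f"
  shows "dirichlet_energy f = 2 * real d * \<nu> * (\<Sum>x\<in>pverts G. (cmod (f x))\<^sup>2)"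
proof -
  have "inner_on (pverts G) (mat_apply (pverts G) (complex_laplacian G) f) f
      = of_real \<nu> * inner_on (pverts G) f f"
    using assms by (simp add: inner_on_def eigenfunction_on_def sum_distrib_left mult.assoc)
  then have "complex_of_real (dirichlet_energy f)
      = of_real (2 * real d * \<nu> * (\<Sum>x\<in>pverts G. (cmod (f x))\<^sup>2))"
    by (simp add: dirichlet_energy_eq_inner_laplacian inner_on_self)
  then show ?thesis
    by (simp only: of_real_eq_iff)
qed

lemma laplacian_eigenvalue_bounds:
  assumes "eigenfunction_on (pverts G) (complex_laplacian G) \<nu> f"
    and "x \<in> pverts G" and "f x \<noteq> 0"
  shows "0 \<le> \<nu>" and "\<nu> \<le> 2"
proof -
  let ?N = "\<Sum>x\<in>pverts G. (cmod (f x))\<^sup>2"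
  have "?N > 0"
    using assms(2,3) pair_finite_verts by (intro sum_pos2) auto
  then have "2 * real d * ?N > 0"
    using degree_pos by simp
  moreover have "0 \<le> (2 * real d * ?N) * \<nu>" "(2 * real d * ?N) * \<nu> \<le> (2 * real d * ?N) * 2"
    using dirichlet_energy_nonneg[of f] dirichlet_energy_le[of f]
    by (simp_all add: dirichlet_energy_eigenfunction[OF assms(1)] mult_ac)
  ultimately show "0 \<le> \<nu>" "\<nu> \<le> 2"
    by (simp_all only: zero_le_mult_iff mult_le_cancel_left) linarith+
qed

lemma eigenfunction_laplacian_const: "eigenfunction_on (pverts G) (complex_laplacian G) 0 (\<lambda>_. c)"
  using degree_pos by (simp add: eigenfunction_on_def mat_apply_laplacian card_neighbours)

lemma card_verts_ge_2:
  assumes "pverts G \<noteq> {}"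
  shows "card (pverts G) \<ge> 2"
proof -
  obtain u where u: "u \<in> pverts G"
    using assms by auto
  then have "card (parcs G `` {u}) > 0"
    using degree_pos by (simp add: card_neighbours)
  then obtain v where "(u, v) \<in> parcs G"
    by (auto simp: card_gt_0_iff)
  then have "{u, v} \<subseteq> pverts G" and "card {u, v} = 2"
    using in_arcsD2 u no_loops' by auto
  then show ?thesis
    using card_mono[OF pair_finite_verts] by metis
qed

end

locale connected_regular_pair_graph = regular_pair_graph +
  assumes connected_graph: "Digraph_Component.connected (with_proj G)"
begin

lemma verts_nonempty: "pverts G \<noteq> {}"
  using connected_graph by (simp add: connected_conv)

lemma constant_if_constant_on_arcs:
  assumes arcs: "\<And>u v. (u, v) \<in> parcs G \<Longrightarrow> f u = f v"
    and "x \<in> pverts G" and "y \<in> pverts G"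
  shows "f x = f y"
proof -
  have "strongly_connected (with_proj G)"
    using pair_sym_arcs connected_graph by (rule symmetric_connected_imp_strongly_connected)
  then have "x \<rightarrow>\<^sup>*\<^bsub>with_proj G\<^esub> y"
    using assms by (auto simp: strongly_connected_def)
  then show ?thesis
    by (induction rule: reachable_induct) (auto dest: arcs)
qed

lemma eigenfunction_laplacian_0_constant:
  assumes "eigenfunction_on (pverts G) (complex_laplacian G) 0 f"
    and "x \<in> pverts G" and "y \<in> pverts G"
  shows "f x = f y"
proof (rule constant_if_constant_on_arcs[OF _ assms(2,3)])
  fix u v assume "(u, v) \<in> parcs G"
  moreover have "dirichlet_energy f = 0"
    by (simp add: dirichlet_energy_eigenfunction[OF assms(1)])
  then have "\<forall>(x, y)\<in>parcs G. (cmod (f x - f y))\<^sup>2 = 0"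
    unfolding dirichlet_energy_def
    by (subst (asm) sum_nonneg_eq_0_iff) (auto simp: pair_finite_arcs)
  ultimately show "f u = f v"
    by fastforce
qed

end

section \<open>Eigensystems of the normalized Laplacian\<close>

lemma orthonormal_eigensystem_imp_orthonormal_eigenbasis:
  assumes system: "orthonormal_eigensystem G ev \<phi>" and "finite (pverts G)"
    and A: "\<And>x y. x \<in> pverts G \<Longrightarrow> y \<in> pverts G \<Longrightarrow> A x y = complex_laplacian G x y"
  shows "orthonormal_eigenbasis (pverts G) {..<card (pverts G)} \<phi> A ev"
  using assms
  by unfold_locales
    (auto simp: orthonormal_eigensystem_def inner_on_def eigenfunction_on_def mat_apply_def A)

lemma generalized_green_eq_spectral_kernel:
  "generalized_green G ev \<phi> \<alpha> x y
    = spectral_kernel {..<card (pverts G)} (\<lambda>j. green_weight \<alpha> (ev j)) \<phi> x y"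
  unfolding generalized_green_def spectral_kernel_def green_weight_def
  by (intro sum.mono_neutral_cong_left) auto

lemma normalized_green_eq_spectral_kernel:
  "normalized_green G ev \<phi> x y
    = spectral_kernel {..<card (pverts G)} (\<lambda>j. green_weight 0 (ev j)) \<phi> x y"
  by (simp add: normalized_green_def generalized_green_eq_spectral_kernel)

lemma holomorphic_on_generalized_green:
  assumes "\<And>j. j < card (pverts G) \<Longrightarrow> ev j > 0 \<Longrightarrow> - of_real (ev j) \<notin> S"
  shows "(\<lambda>\<alpha>. generalized_green G ev \<phi> \<alpha> x y) holomorphic_on S"
  unfolding generalized_green_def using assms
  by (intro holomorphic_intros) (auto simp: add_eq_0_iff)

locale laplacian_eigensystem = connected_regular_pair_graph G d
  for G :: "'a pair_pre_digraph" and d +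
  fixes ev :: "nat \<Rightarrow> real" and \<phi> :: "nat \<Rightarrow> 'a \<Rightarrow> complex"
  assumes system: "orthonormal_eigensystem G ev \<phi>"

lemma laplacian_eigensystemI:
  assumes "pair_graph G" and "Digraph_Component.connected (with_proj G)" and "regular_graph G d"
    and "d \<ge> 1" and "orthonormal_eigensystem G ev \<phi>"
  shows "laplacian_eigensystem G d ev \<phi>"
  using assms by (simp add: laplacian_eigensystem_def laplacian_eigensystem_axioms_def
      connected_regular_pair_graph_def connected_regular_pair_graph_axioms_def
      regular_pair_graph_def regular_pair_graph_axioms_def)

sublocale laplacian_eigensystem \<subseteq>
  basis: orthonormal_eigenbasis "pverts G" "{..<card (pverts G)}" \<phi> "complex_laplacian G" ev
  using system pair_finite_verts by (rule orthonormal_eigensystem_imp_orthonormal_eigenbasis) simp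

context laplacian_eigensystem
begin

lemma eigenvalue_bounds:
  assumes "j < card (pverts G)"
  shows "0 \<le> ev j" and "ev j \<le> 2"
proof -
  have "inner_on (pverts G) (\<phi> j) (\<phi> j) \<noteq> 0"
    using assms by (simp add: basis.orthonormal)
  then obtain x where nonzero: "x \<in> pverts G" "\<phi> j x \<noteq> 0"
    by (auto simp: inner_on_def elim: sum.not_neutral_contains_not_neutral)
  have eigen: "eigenfunction_on (pverts G) (complex_laplacian G) (ev j) (\<phi> j)"
    using assms by (simp add: basis.eigenfunction)
  show "0 \<le> ev j" "ev j \<le> 2"
    using laplacian_eigenvalue_bounds[OF eigen nonzero] by simp_all
qed

lemma zero_eigenprojection:
  assumes x: "x \<in> pverts G" and y: "y \<in> pverts G"
  shows "spectral_kernel {..<card (pverts G)} (\<lambda>j. of_bool (ev j = 0)) \<phi> x y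
    = 1 / of_nat (card (pverts G))"
proof -
  let ?Z = "spectral_kernel {..<card (pverts G)} (\<lambda>j. of_bool (ev j = 0)) \<phi>"
  have "of_bool (ev j = 0) * \<phi> j x * cnj (\<phi> j y) = of_bool (ev j = 0) * \<phi> j x * cnj (\<phi> j z)"
    if "j < card (pverts G)" "z \<in> pverts G" for j z
    using basis.eigenfunction[of j] eigenfunction_laplacian_0_constant[of "\<phi> j" y z] that y
    by (cases "ev j = 0") auto
  then have "?Z x y = ?Z x z" if "z \<in> pverts G" for z
    unfolding spectral_kernel_def using that by (intro sum.cong refl) blast
  then have "(\<Sum>z\<in>pverts G. ?Z x y) = (\<Sum>z\<in>pverts G. ?Z x z)"
    by (intro sum.cong refl)
  then have "of_nat (card (pverts G)) * ?Z x y = mat_apply (pverts G) ?Z (\<lambda>_. 1) x"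
    by (simp add: mat_apply_def)
  also have "\<dots> = 1"
    using basis.eigenfunction_spectral_kernel[OF eigenfunction_laplacian_const x,
        of "\<lambda>t. of_bool (t = 0)" 1]
    by simp
  finally show ?thesis
    using verts_nonempty pair_finite_verts by (simp add: eq_divide_eq mult.commute)
qed

lemma card_zero_eigenvalues: "card {j. j < card (pverts G) \<and> ev j = 0} = 1"
proof -
  have "complex_of_nat (card {j. j < card (pverts G) \<and> ev j = 0})
      = (\<Sum>j<card (pverts G). of_bool (ev j = 0))"
    by (simp add: Int_def lessThan_def)
  also have "\<dots> = (\<Sum>x\<in>pverts G. 1 / of_nat (card (pverts G)))"
    unfolding basis.trace_spectral_kernel[symmetric] by (intro sum.cong refl zero_eigenprojection)
  also have "\<dots> = of_nat 1"
    using verts_nonempty pair_finite_verts by simp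
  finally show ?thesis
    by (simp only: of_nat_eq_iff)
qed

lemma sorted_eigenvalue_eq_0_iff:
  assumes sorted: "mono_on {..<card (pverts G)} ev" and k: "k < card (pverts G)"
  shows "ev k = 0 \<longleftrightarrow> k = 0"
proof -
  obtain z where zeros: "{j. j < card (pverts G) \<and> ev j = 0} = {z}"
    using card_zero_eigenvalues by (auto simp: card_1_singleton_iff)
  have unique: "ev j = 0 \<longleftrightarrow> j = z" if "j < card (pverts G)" for j
  proof -
    have "j \<in> {j. j < card (pverts G) \<and> ev j = 0} \<longleftrightarrow> j \<in> {z}"
      unfolding zeros ..
    with that show ?thesis
      by simp
  qed
  have z: "z < card (pverts G)"
    using zeros by blast
  have "ev 0 \<le> ev z"
    using z by (intro mono_onD[OF sorted]) auto
  then have "ev 0 = 0"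
    using z unique[OF z] eigenvalue_bounds(1)[of 0] by simp
  then have "0 = z"
    using z unique[of 0] by simp
  then show ?thesis
    using unique[OF k] by simp
qed

lemma sorted_positive_eigenvalue_bounds:
  assumes sorted: "mono_on {..<card (pverts G)} ev"
  shows "0 < ev 1"
    and "k < card (pverts G) \<Longrightarrow> 0 < ev k \<Longrightarrow> ev 1 \<le> ev k"
proof -
  have one: "1 < card (pverts G)"
    using card_verts_ge_2[OF verts_nonempty] by simp
  then show "0 < ev 1"
    using sorted_eigenvalue_eq_0_iff[OF sorted one] eigenvalue_bounds(1)[OF one] by simp
  assume k: "k < card (pverts G)" "0 < ev k"
  then have "k \<ge> 1"
    using sorted_eigenvalue_eq_0_iff[OF sorted k(1)] by simp
  then show "ev 1 \<le> ev k"
    using sorted one k by (auto simp: mono_on_def)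
qed

lemma positive_eigenvalue_in_ball:
  assumes sorted: "mono_on {..<card (pverts G)} ev" and k: "k < card (pverts G)" "0 < ev k"
  shows "of_real (ev k) \<in> ball (of_real (2 + ev 1 / 2) :: complex) 2"
proof -
  have "\<bar>2 + ev 1 / 2 - ev k\<bar> < 2"
    using sorted_positive_eigenvalue_bounds(1)[OF sorted]
      sorted_positive_eigenvalue_bounds(2)[OF sorted k] eigenvalue_bounds(2)[OF k(1)]
    by linarith
  then show ?thesis
    by (simp only: mem_ball dist_of_real dist_real_def)
qed

end

section \<open>The Green's function of a Cartesian product\<close>

lemma arc_cartesian_product_iff:
  assumes "x \<in> pverts G" and "x' \<in> pverts H"
  shows "((x, x'), (y, y')) \<in> parcs (cartesian_product G H)
    \<longleftrightarrow> (x, y) \<in> parcs G \<and> x' = y' \<or> x = y \<and> (x', y') \<in> parcs H"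
  using assms by (auto simp: cartesian_product_def)

lemma out_degree_cartesian_product:
  assumes "regular_pair_graph G d" and "regular_pair_graph H e"
    and x: "x \<in> pverts G" and x': "x' \<in> pverts H"
  shows "out_degree (with_proj (cartesian_product G H)) (x, x') = d + e"
proof -
  interpret G: regular_pair_graph G d by fact
  interpret H: regular_pair_graph H e by fact
  have "parcs (cartesian_product G H) `` {(x, x')} = parcs G `` {x} \<times> {x'} \<union> {x} \<times> parcs H `` {x'}"
    by (auto simp: arc_cartesian_product_iff[OF x x'])
  moreover have "(parcs G `` {x} \<times> {x'}) \<inter> ({x} \<times> parcs H `` {x'}) = {}"
    by (auto dest: G.no_loops')
  ultimately show ?thesis
    using x x' by (simp add: out_degree_with_proj card_Un_disjoint card_cartesian_product
        G.finite_neighbours H.finite_neighbours G.card_neighbours H.card_neighbours)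
qed

lemma laplacian_cartesian_product:
  assumes "regular_pair_graph G d" and "regular_pair_graph H e"
    and x: "x \<in> pverts G" and x': "x' \<in> pverts H"
  shows "complex_laplacian (cartesian_product G H) (x, x') (y, y')
    = weighted_kronecker_sum (real d / real (d + e)) (complex_laplacian G)
        (real e / real (d + e)) (complex_laplacian H) (x, x') (y, y')"
proof -
  interpret G: regular_pair_graph G d by fact
  interpret H: regular_pair_graph H e by fact
  let ?P = "cartesian_product G H"
  have no_loops: "(x, x) \<notin> parcs G" "(x', x') \<notin> parcs H"
    by (auto dest: G.no_loops' H.no_loops')
  note arc_iff = arc_cartesian_product_iff[OF x x']
    and degree = out_degree_cartesian_product[OF assms]
  have "normalized_laplacian ?P (x, x') (y, y')
      = of_bool (x = y) * of_bool (x' = y') - of_bool (((x, x'), (y, y')) \<in> parcs ?P) / (d + e)"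
    using no_loops by (auto simp: normalized_laplacian_def degree arc_iff)
  also have "of_bool (((x, x'), (y, y')) \<in> parcs ?P)
      = of_bool ((x, y) \<in> parcs G) * of_bool (x' = y')
        + of_bool (x = y) * (of_bool ((x', y') \<in> parcs H) :: real)"
    using no_loops by (auto simp: arc_iff)
  also have "u * u' - (p * u' + u * p') / (d + e)
      = d / (d + e) * ((u - p / d) * u') + e / (d + e) * (u * (u' - p' / e))" for u u' p p' :: real
  proof -
    have "real d > 0" "real e > 0" "real (d + e) > 0"
      using G.degree_pos H.degree_pos by simp_all
    then show ?thesis
      by (simp add: divide_simps) (simp add: algebra_simps)
  qed
  finally have "normalized_laplacian ?P (x, x') (y, y')
      = d / (d + e) * (normalized_laplacian G x y * of_bool (x' = y'))
        + e / (d + e) * (of_bool (x = y) * normalized_laplacian H x' y')"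
    by (simp only: G.normalized_laplacian_eq[OF x] H.normalized_laplacian_eq[OF x'])
  then show ?thesis
    by (simp only: weighted_kronecker_sum_def case_prod_conv
        of_real_add of_real_mult of_real_of_bool)
qed

lemma orthonormal_eigenbasis_cartesian_product:
  assumes "regular_pair_graph G d" and "regular_pair_graph H e"
    and system: "orthonormal_eigensystem (cartesian_product G H) ev \<phi>"
  shows "orthonormal_eigenbasis (pverts G \<times> pverts H) {..<card (pverts (cartesian_product G H))} \<phi>
    (weighted_kronecker_sum (real d / real (d + e)) (complex_laplacian G)
      (real e / real (d + e)) (complex_laplacian H)) ev"
proof -
  interpret G: regular_pair_graph G d by fact
  interpret H: regular_pair_graph H e by fact
  let ?P = "cartesian_product G H"
  let ?K = "weighted_kronecker_sum (real d / real (d + e)) (complex_laplacian G)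
    (real e / real (d + e)) (complex_laplacian H)"
  have verts: "pverts ?P = pverts G \<times> pverts H"
    by (simp add: cartesian_product_def)
  have "finite (pverts ?P)"
    by (simp add: verts G.pair_finite_verts H.pair_finite_verts)
  moreover have "?K p q = complex_laplacian ?P p q" if "p \<in> pverts ?P" for p q
    using that laplacian_cartesian_product[OF assms(1,2)] by (cases p; cases q) (simp add: verts)
  ultimately show ?thesis
    using orthonormal_eigensystem_imp_orthonormal_eigenbasis[OF system, of ?K] by (simp add: verts)
qed

lemma normalized_green_cartesian_product:
  assumes "laplacian_eigensystem G d ev \<phi>" and "laplacian_eigensystem H e ev' \<phi>'"
    and system: "orthonormal_eigensystem (cartesian_product G H) evP \<phi>P"
    and x: "x \<in> pverts G" and y: "y \<in> pverts G" and x': "x' \<in> pverts H" and y': "y' \<in> pverts H"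
  shows "normalized_green (cartesian_product G H) evP \<phi>P (x, x') (y, y')
    = of_nat (d + e) / of_nat d * (\<Sum>k | k < card (pverts H) \<and> ev' k > 0.
          generalized_green G ev \<phi> (of_real (e / d * ev' k)) x y * (\<phi>' k x' * cnj (\<phi>' k y')))
      + of_nat (d + e) / (of_nat d * of_nat (card (pverts H))) * normalized_green G ev \<phi> x y
      + of_nat (d + e) / (of_nat e * of_nat (card (pverts G))) * normalized_green H ev' \<phi>' x' y'"
proof -
  interpret G: laplacian_eigensystem G d ev \<phi> by fact
  interpret H: laplacian_eigensystem H e ev' \<phi>' by fact
  let ?P = "cartesian_product G H" and ?I = "{..<card (pverts G)}" and ?J = "{..<card (pverts H)}"
  let ?a = "real d / real (d + e)" and ?b = "real e / real (d + e)"
  let ?K = "weighted_kronecker_sum ?a (complex_laplacian G) ?b (complex_laplacian H)"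
  have given_basis: "orthonormal_eigenbasis (pverts G \<times> pverts H) {..<card (pverts ?P)} \<phi>P ?K evP"
    using G.regular_pair_graph_axioms H.regular_pair_graph_axioms system
    by (rule orthonormal_eigenbasis_cartesian_product)
  have tensor_basis: "orthonormal_eigenbasis (pverts G \<times> pverts H) (?I \<times> ?J)
      (\<lambda>(j, k). tensor (\<phi> j) (\<phi>' k)) ?K (\<lambda>(j, k). ?a * ev j + ?b * ev' k)"
    using G.basis.orthonormal_eigenbasis_axioms H.basis.orthonormal_eigenbasis_axioms
    by (rule orthonormal_eigenbasis_weighted_kronecker_sum)
  have weights: "?a > 0" "?b > 0" "?b / ?a = e / d"
    using G.degree_pos H.degree_pos by simp_all
  have "normalized_green ?P evP \<phi>P (x, x') (y, y')
      = spectral_kernel (?I \<times> ?J) (\<lambda>l. green_weight 0 ((\<lambda>(j, k). ?a * ev j + ?b * ev' k) l))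
          (\<lambda>(j, k). tensor (\<phi> j) (\<phi>' k)) (x, x') (y, y')"
    unfolding normalized_green_eq_spectral_kernel using x y x' y'
    by (intro spectral_kernel_unique[OF given_basis tensor_basis]) auto
  also have "\<dots> = spectral_kernel (?I \<times> ?J) (\<lambda>(j, k). green_weight 0 (?a * ev j + ?b * ev' k))
      (\<lambda>(j, k). tensor (\<phi> j) (\<phi>' k)) (x, x') (y, y')"
    by (simp only: case_prod_unfold)
  also have "\<dots> = (\<Sum>k | k \<in> ?J \<and> ev' k > 0. generalized_green G ev \<phi> (of_real (e / d * ev' k)) x y
          * (\<phi>' k x' * cnj (\<phi>' k y'))) / of_real ?a
      + normalized_green G ev \<phi> x y * (1 / of_nat (card (pverts H))) / of_real ?a
      + 1 / of_nat (card (pverts G)) * normalized_green H ev' \<phi>' x' y' / of_real ?b"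
    unfolding generalized_green_eq_spectral_kernel normalized_green_eq_spectral_kernel
      G.zero_eigenprojection[OF x y, symmetric] H.zero_eigenprojection[OF x' y', symmetric]
      weights(3)[symmetric]
    using G.eigenvalue_bounds H.eigenvalue_bounds weights(1,2)
    by (intro spectral_kernel_green_weight_tensor) simp_all
  finally show ?thesis
    by (simp add: mult.commute)
qed

section \<open>The contour integral\<close>

lemma contour_integral_circlepath_simple_poles:
  assumes f: "f holomorphic_on cball z r" and a: "\<And>k. k \<in> K \<Longrightarrow> a k \<in> ball z r" and "finite K"
  shows "contour_integral (circlepath z r) (\<lambda>\<alpha>. f \<alpha> * (\<Sum>k\<in>K. b k / (\<alpha> - a k)))
    = 2 * of_real pi * \<i> * (\<Sum>k\<in>K. f (a k) * b k)"
proof -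
  have "((\<lambda>\<alpha>. \<Sum>k\<in>K. b k * (f \<alpha> / (\<alpha> - a k))) has_contour_integral
      (\<Sum>k\<in>K. b k * (2 * of_real pi * \<i> * f (a k)))) (circlepath z r)"
    using a \<open>finite K\<close>
    by (intro has_contour_integral_sum has_contour_integral_lmul Cauchy_integral_circlepath_simple f)
      (auto simp: dist_norm norm_minus_commute)
  then show ?thesis
    by (simp add: contour_integral_unique sum_distrib_left mult_ac)
qed

lemma contour_integral_generalized_green:
  assumes f: "f holomorphic_on cball z r"
    and poles: "\<And>k. k < card (pverts G) \<Longrightarrow> ev k > 0 \<Longrightarrow> of_real (ev k) \<in> ball z r"
  shows "contour_integral (reversepath (circlepath z r))
      (\<lambda>\<alpha>. f \<alpha> * generalized_green G ev \<phi> (- \<alpha>) x y)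
    = 2 * of_real pi * \<i> *
      (\<Sum>k | k < card (pverts G) \<and> ev k > 0. f (of_real (ev k)) * (\<phi> k x * cnj (\<phi> k y)))"
proof -
  let ?K = "{k. k < card (pverts G) \<and> ev k > 0}" and ?p = "\<lambda>k. \<phi> k x * cnj (\<phi> k y)"
  have "generalized_green G ev \<phi> (- \<alpha>) x y = (\<Sum>k\<in>?K. - ?p k / (\<alpha> - of_real (ev k)))" for \<alpha>
    unfolding generalized_green_def
    by (intro sum.cong refl)
      (simp only: minus_divide_left[symmetric] minus_divide_right minus_diff_eq add_uminus_conv_diff
        times_divide_eq_left mult_1_left)
  then have "contour_integral (reversepath (circlepath z r))
      (\<lambda>\<alpha>. f \<alpha> * generalized_green G ev \<phi> (- \<alpha>) x y)
      = - contour_integral (circlepath z r) (\<lambda>\<alpha>. f \<alpha> * (\<Sum>k\<in>?K. - ?p k / (\<alpha> - of_real (ev k))))"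
    by (simp add: contour_integral_reversepath)
  also have "\<dots> = - (2 * of_real pi * \<i> * (\<Sum>k\<in>?K. f (of_real (ev k)) * - ?p k))"
    using poles by (subst contour_integral_circlepath_simple_poles[OF f]) auto
  finally show ?thesis
    by (simp add: sum_negf)
qed

lemma Re_pos_if_mem_cball:
  assumes "\<alpha> \<in> cball c r" and "r < Re c"
  shows "Re \<alpha> > 0"
  using assms abs_Re_le_cmod[of "c - \<alpha>"] by (simp add: dist_norm)

theorem theorem8:
  fixes \<Gamma> :: "'a pair_pre_digraph" and \<Gamma>' :: "'b pair_pre_digraph"
    and d m n :: nat
    and ev ev' evP :: "nat \<Rightarrow> real"
    and \<phi> :: "nat \<Rightarrow> 'a \<Rightarrow> complex"
    and \<phi>' :: "nat \<Rightarrow> 'b \<Rightarrow> complex"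
    and \<phi>P :: "nat \<Rightarrow> 'a \<times> 'b \<Rightarrow> complex"
    and x y :: 'a and x' y' :: 'b
  assumes "pair_graph \<Gamma>" and "Digraph_Component.connected (with_proj \<Gamma>)" and "regular_graph \<Gamma> d"
    and "pair_graph \<Gamma>'" and "Digraph_Component.connected (with_proj \<Gamma>')" and "regular_graph \<Gamma>' d"
    and "d \<ge> 1"
    and "m = card (pverts \<Gamma>)" and "n = card (pverts \<Gamma>')"
    and "orthonormal_eigensystem \<Gamma> ev \<phi>"
    and "orthonormal_eigensystem \<Gamma>' ev' \<phi>'" and "mono_on {..<n} ev'"
    and "orthonormal_eigensystem (cartesian_product \<Gamma> \<Gamma>') evP \<phi>P"
    and "x \<in> pverts \<Gamma>" and "y \<in> pverts \<Gamma>" and "x' \<in> pverts \<Gamma>'" and "y' \<in> pverts \<Gamma>'"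
  shows "normalized_green (cartesian_product \<Gamma> \<Gamma>') evP \<phi>P (x, x') (y, y') =
      1 / (of_real pi * \<i>) *
        contour_integral (reversepath (circlepath (of_real (2 + ev' 1 / 2)) 2))
          (\<lambda>\<alpha>. generalized_green \<Gamma> ev \<phi> \<alpha> x y * generalized_green \<Gamma>' ev' \<phi>' (- \<alpha>) x' y')
      + 2 / of_nat n * normalized_green \<Gamma> ev \<phi> x y
      + 2 / of_nat m * normalized_green \<Gamma>' ev' \<phi>' x' y'"
proof -
  interpret G: laplacian_eigensystem \<Gamma> d ev \<phi>
    using assms by (intro laplacian_eigensystemI)
  interpret H: laplacian_eigensystem \<Gamma>' d ev' \<phi>'
    using assms by (intro laplacian_eigensystemI)
  let ?c = "of_real (2 + ev' 1 / 2) :: complex"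
  let ?S = "\<Sum>k | k < card (pverts \<Gamma>') \<and> ev' k > 0.
    generalized_green \<Gamma> ev \<phi> (of_real (ev' k)) x y * (\<phi>' k x' * cnj (\<phi>' k y'))"
  have sorted: "mono_on {..<card (pverts \<Gamma>')} ev'"
    using assms by simp
  have "(\<lambda>\<alpha>. generalized_green \<Gamma> ev \<phi> \<alpha> x y) holomorphic_on cball ?c 2"
    using Re_pos_if_mem_cball[of _ ?c 2] H.sorted_positive_eigenvalue_bounds(1)[OF sorted]
    by (intro holomorphic_on_generalized_green) fastforce
  then have "contour_integral (reversepath (circlepath ?c 2))
      (\<lambda>\<alpha>. generalized_green \<Gamma> ev \<phi> \<alpha> x y * generalized_green \<Gamma>' ev' \<phi>' (- \<alpha>) x' y')
    = 2 * of_real pi * \<i> * ?S"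
    using H.positive_eigenvalue_in_ball[OF sorted] by (rule contour_integral_generalized_green)
  moreover have "normalized_green (cartesian_product \<Gamma> \<Gamma>') evP \<phi>P (x, x') (y, y')
      = 2 * ?S + 2 / of_nat n * normalized_green \<Gamma> ev \<phi> x y
        + 2 / of_nat m * normalized_green \<Gamma>' ev' \<phi>' x' y'"
    using normalized_green_cartesian_product[OF G.laplacian_eigensystem_axioms
        H.laplacian_eigensystem_axioms assms(13-17)] G.degree_pos assms(8,9)
    by (simp add: mult.commute)
  ultimately show ?thesis
    by (simp add: field_simps)
qed

end
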